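(* Let $n\ge 2$ be an integer with prime factorization $n=p_1^{e_1}p_2^{e_2}\cdots p_\omega^{e_\omega}$ (with $p_1,\dots,p_\omega$ distinct primes and each $e_i\ge 1$), let $m\ge 1$ be an integer, and let $A$ be an $m\times m$ matrix over $\mathbb{Z}_n$. Put $$\mu_{\mathrm A}=m\cdot\max\{e_1,\dots,e_\omega\},\qquad \mu_{\mathrm B}=\max\{s_1e_1,\,s_2e_2,\dots,s_\omega e_\omega\},$$ where $s_i$ is the system height of the reduced system $(\mathbb{Z}_{p_i}^m,\,A\bmod p_i)$ for $i=1,\dots,\omega$. Then $$\mu_{\mathrm B}\le\mu_{\mathrm A}\le\lceil m\log_2(n)\rceil .$$
   Context: $\mathbb{Z}_n$ denotes the ring of integers modulo $n$. A finite dynamical system is a pair $(X,f)$ with $X$ a finite set and $f:X\to X$ a function. An element $x_0\in X$ is a cycle vertex if $f^l(x_0)=x_0$ for some positive integer $l$. The height $h(x)$ of $x\in X$ is the number of iterations it takes for $x$ to reach a cycle vertex, i.e. the smallest integer $k\ge 0$ such that $f^k(x)$ is a cycle vertex. The system height of $(X,f)$ is $\max_{x\in X}h(x)$. For a divisor $d$ of $n$, $A\bmod d$ is the matrix over $\mathbb{Z}_d$ obtained by reducing the entries of $A$ modulo $d$, and $(\mathbb{Z}_d^m,A\bmod d)$ is the finite dynamical system on $\mathbb{Z}_d^m$ given by $x\mapsto (A\bmod d)x$. *)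

theory Defs
  imports Complex_Main "HOL-Number_Theory.Residues" "Jordan_Normal_Form.Matrix"
begin

definition finite_dynamical_system :: "'a set \<Rightarrow> ('a \<Rightarrow> 'a) \<Rightarrow> bool" where
  "finite_dynamical_system X f \<longleftrightarrow> finite X \<and> f \<in> X \<rightarrow> X"

definition cycle_vertex :: "'a set \<Rightarrow> ('a \<Rightarrow> 'a) \<Rightarrow> 'a \<Rightarrow> bool" where
  "cycle_vertex X f x \<longleftrightarrow> x \<in> X \<and> (\<exists>l>0. (f ^^ l) x = x)"

definition height :: "'a set \<Rightarrow> ('a \<Rightarrow> 'a) \<Rightarrow> 'a \<Rightarrow> nat" where
  "height X f x = (LEAST k. cycle_vertex X f ((f ^^ k) x))"

definition system_height :: "'a set \<Rightarrow> ('a \<Rightarrow> 'a) \<Rightarrow> nat" where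
  "system_height X f = Max (height X f ` X)"

text \<open>Vectors and matrices over \<open>\<int>\<^sub>d\<close>: the entries are elements of the library ring
  \<^term>\<open>residue_ring (int d)\<close>, whose carrier consists of the representatives \<open>0, \<dots>, d - 1\<close>,
  and all sums and products are taken in that ring.\<close>

definition Zvec :: "nat \<Rightarrow> nat \<Rightarrow> int vec set" where
  "Zvec d m = {x \<in> carrier_vec m. \<forall>i<m. x $ i \<in> carrier (residue_ring (int d))}"

definition Zmat :: "nat \<Rightarrow> nat \<Rightarrow> int mat set" where
  "Zmat d m = {A \<in> carrier_mat m m. \<forall>i<m. \<forall>j<m. A $$ (i, j) \<in> carrier (residue_ring (int d))}"

definition Zmult_mat_vec :: "nat \<Rightarrow> int mat \<Rightarrow> int vec \<Rightarrow> int vec" where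
  "Zmult_mat_vec d A x = vec (dim_row A) (\<lambda>i.
     \<Oplus>\<^bsub>residue_ring (int d)\<^esub>j\<in>{..<dim_vec x}. A $$ (i, j) \<otimes>\<^bsub>residue_ring (int d)\<^esub> x $ j)"

definition mat_mod :: "int mat \<Rightarrow> nat \<Rightarrow> int mat" where
  "mat_mod A d = map_mat (\<lambda>a. a mod int d) A"

lemma mat_mod_in_Zmat: "A \<in> carrier_mat m m \<Longrightarrow> d > 0 \<Longrightarrow> mat_mod A d \<in> Zmat d m"
  by (auto simp: Zmat_def mat_mod_def residue_ring_def)

lemma finite_dynamical_system_Zmult_mat_vec:
  assumes "d > 1" "B \<in> Zmat d m"
  shows "finite_dynamical_system (Zvec d m) (Zmult_mat_vec d B)"
proof -
  interpret R: residues "int d" "residue_ring (int d)"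
    using assms(1) by unfold_locales auto
  have "Zvec d m \<subseteq> vec_of_list ` {xs. set xs \<subseteq> {0..int d - 1} \<and> length xs = m}"
  proof
    fix x assume x: "x \<in> Zvec d m"
    have "set (list_of_vec x) \<subseteq> {0..int d - 1}" "length (list_of_vec x) = m"
      using x by (auto simp: Zvec_def residue_ring_def in_set_conv_nth list_of_vec_index)
    moreover have "x = vec_of_list (list_of_vec x)" by (simp add: vec_list)
    ultimately show "x \<in> vec_of_list ` {xs. set xs \<subseteq> {0..int d - 1} \<and> length xs = m}"
      by blast
  qed
  then have "finite (Zvec d m)"
    by (rule finite_subset) (intro finite_imageI finite_lists_length_eq, simp)
  moreover have "Zmult_mat_vec d B x \<in> Zvec d m" if x: "x \<in> Zvec d m" for x
  proof -
    have "(\<Oplus>\<^bsub>residue_ring (int d)\<^esub>j\<in>{..<m}. B $$ (i, j) \<otimes>\<^bsub>residue_ring (int d)\<^esub> x $ j)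
        \<in> carrier (residue_ring (int d))" if "i < m" for i
      using x assms(2) that by (intro R.finsum_closed) (auto simp: Zvec_def Zmat_def)
    then show ?thesis
      using x assms(2) by (auto simp: Zmult_mat_vec_def Zvec_def Zmat_def)
  qed
  ultimately show ?thesis by (auto simp: finite_dynamical_system_def)
qed

end

theory Submission
  imports Defs "HOL-Algebra.Coset"
begin

text \<open>
  The first inequality holds because every system height \<open>s\<^sub>i\<close> is at most \<open>m\<close>.  In a finite system
  \<open>(X, f)\<close> the iterated images \<open>X \<supseteq> f X \<supseteq> f\<^sup>2 X \<supseteq> \<dots>\<close> shrink strictly until they become
  stationary; once they are, \<open>f\<close> permutes the remaining points, so all of them lie on cycles.
  Hence the images shrink strictly at each of the first \<open>s\<^sub>i\<close> steps
  (\<open>image_funpow_psubset\<close>).  Since \<open>x \<mapsto> A x\<close> is an endomorphism of the additive group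
  \<open>\<int>\<^sub>p\<^sup>m\<close>, the images are subgroups, and by Lagrange their orders are powers of \<open>p\<close> dividing
  \<open>p\<^sup>m\<close>.  The exponents start at \<open>m\<close> and drop with every strict inclusion, so there are at most
  \<open>m\<close> of these (\<open>system_height_endomorphism_le\<close>).

  The second inequality follows from \<open>2 ^ e\<^sub>i \<le> p\<^sub>i ^ e\<^sub>i \<le> n\<close> by taking logarithms.
\<close>

text \<open>A surjective self-map of the finite set \<open>Y\<close> is a permutation of it.  Some orbit repeats, say
  \<open>f\<^sup>a y = f\<^sup>b y\<close> with \<open>a < b\<close>, and injectivity of \<open>f\<^sup>a\<close> allows cancelling the first \<open>a\<close> steps.\<close>

lemma cycle_vertex_if_image_eq:
  assumes "finite Y" "f ` Y = Y" "Y \<subseteq> X" "y \<in> Y"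
  shows "cycle_vertex X f y"
proof -
  have "bij_betw f Y Y"
    using assms by (simp add: bij_betw_def finite_surj_inj)
  then have bij: "bij_betw (f ^^ k) Y Y" for k
    by (rule bij_betw_funpow)
  then have orbit: "(f ^^ k) y \<in> Y" for k
    using assms(4) bij_betwE by blast
  then have "finite (range (\<lambda>k. (f ^^ k) y))"
    using assms(1) by (meson finite_subset image_subsetI)
  then have "\<not> inj (\<lambda>k. (f ^^ k) y)"
    using finite_imageD infinite_UNIV_nat by blast
  then obtain a b where ab: "a < b" "(f ^^ a) y = (f ^^ b) y"
    by (auto simp: inj_def) (metis linorder_neqE_nat)
  have "(f ^^ b) y = (f ^^ a) ((f ^^ (b - a)) y)"
    using ab(1) by (metis comp_apply funpow_add le_add_diff_inverse less_imp_le)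
  with ab(2) have "(f ^^ a) ((f ^^ (b - a)) y) = (f ^^ a) y"
    by simp
  then have "(f ^^ (b - a)) y = y"
    using bij[of a] orbit assms(4) by (auto simp: bij_betw_def inj_on_eq_iff)
  with ab(1) assms(3,4) show ?thesis
    unfolding cycle_vertex_def by (metis subsetD zero_less_diff)
qed

lemma image_funpow_decreasing:
  assumes "f \<in> X \<rightarrow> X"
  shows "(f ^^ Suc k) ` X \<subseteq> (f ^^ k) ` X" "(f ^^ k) ` X \<subseteq> X"
proof -
  have "(f ^^ Suc k) x = (f ^^ k) (f x)" for x
    by (simp add: funpow_swap1)
  then show "(f ^^ Suc k) ` X \<subseteq> (f ^^ k) ` X"
    using assms by auto
  show "(f ^^ k) ` X \<subseteq> X"
    using assms by (induction k) auto
qed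

text \<open>If the images agreed at step \<open>k\<close>, then \<open>f\<close> would permute \<open>f\<^sup>k X\<close> and every point would reach a
  cycle within \<open>k\<close> steps.\<close>

lemma image_funpow_psubset:
  assumes fin: "finite X" and f: "f \<in> X \<rightarrow> X" and k: "k < system_height X f"
    and ne: "X \<noteq> {}"
  shows "(f ^^ Suc k) ` X \<subset> (f ^^ k) ` X"
proof (rule ccontr)
  assume "\<not> ?thesis"
  then have "(f ^^ Suc k) ` X = (f ^^ k) ` X"
    using image_funpow_decreasing(1)[OF f, of k] by blast
  then have stable: "f ` ((f ^^ k) ` X) = (f ^^ k) ` X"
    by (simp add: image_image)
  have "height X f x \<le> k" if "x \<in> X" for x
    unfolding height_def
    using that fin image_funpow_decreasing(2)[OF f, of k]
    by (intro Least_le cycle_vertex_if_image_eq[OF _ stable]) auto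
  then have "system_height X f \<le> k"
    unfolding system_height_def using fin ne by simp
  with k show False by simp
qed

text \<open>The images \<open>f\<^sup>k G\<close> are subgroups of a \<open>p\<close>-group, hence of order a power of \<open>p\<close>, so every strict
  inclusion in the chain costs at least one of the \<open>m\<close> factors \<open>p\<close> in the order of \<open>G\<close>.\<close>

lemma (in group) system_height_endomorphism_le:
  assumes p: "prime (p::nat)" and ord: "order G = p ^ m" and f: "f \<in> hom G G"
  shows "system_height (carrier G) f \<le> m"
proof -
  let ?X = "carrier G"
  have fX: "f \<in> ?X \<rightarrow> ?X"
    using f by (auto simp: hom_def)
  have fin: "finite ?X"
    using ord p by (metis order_gt_0_iff_finite prime_gt_0_nat zero_less_power)
  have funpow_hom: "f ^^ k \<in> hom G G" for k
  proof (induction k)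
    case 0
    then show ?case by (simp add: hom_def)
  next
    case (Suc k)
    then show ?case using f by (auto simp: hom_def Pi_iff)
  qed
  have sub: "subgroup ((f ^^ k) ` ?X) G" for k
    by (intro group_hom.img_is_subgroup group_hom.intro group_hom_axioms.intro
        group_axioms funpow_hom)
  \<comment> \<open>By step \<open>k\<close> at least \<open>k\<close> factors \<open>p\<close> have been lost.\<close>
  have "k \<le> system_height ?X f \<Longrightarrow> \<exists>j. card ((f ^^ k) ` ?X) = p ^ j \<and> j + k \<le> m" for k
  proof (induction k)
    case 0
    then show ?case using ord by (auto simp: order_def)
  next
    case (Suc k)
    then obtain j where j: "card ((f ^^ k) ` ?X) = p ^ j" "j + k \<le> m"
      by auto
    have "card ((f ^^ Suc k) ` ?X) dvd p ^ m"
      using lagrange[OF sub] ord by (metis dvd_triv_right)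
    then obtain i where i: "card ((f ^^ Suc k) ` ?X) = p ^ i"
      using p by (auto simp: divides_primepow_nat)
    have "card ((f ^^ Suc k) ` ?X) < card ((f ^^ k) ` ?X)"
      using fin Suc.prems one_closed
      by (intro psubset_card_mono image_funpow_psubset fX) auto
    then have "i < j"
      using i j p by (metis prime_gt_1_nat power_less_imp_less_exp)
    then show ?case using i j by (intro exI[of _ i]) simp
  qed
  from this[of "system_height ?X f"] show ?thesis by auto
qed

definition Zvec_group :: "nat \<Rightarrow> nat \<Rightarrow> int vec monoid" where
  "Zvec_group d m = \<lparr>carrier = Zvec d m,
     monoid.mult = (\<lambda>x y. vec m (\<lambda>i. x $ i \<oplus>\<^bsub>residue_ring (int d)\<^esub> y $ i)),
     monoid.one = vec m (\<lambda>_. \<zero>\<^bsub>residue_ring (int d)\<^esub>)\<rparr>"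

lemma residues_of_nat: "d > 1 \<Longrightarrow> residues (int d)"
  by unfold_locales auto

lemma group_Zvec_group:
  assumes "d > 1"
  shows "group (Zvec_group d m)"
proof -
  interpret R: residues "int d" "residue_ring (int d)"
    using residues_of_nat[OF assms] .
  show ?thesis
  proof (rule groupI)
    fix x assume "x \<in> carrier (Zvec_group d m)"
    then show "\<exists>y\<in>carrier (Zvec_group d m). y \<otimes>\<^bsub>Zvec_group d m\<^esub> x = \<one>\<^bsub>Zvec_group d m\<^esub>"
      by (intro bexI[of _ "vec m (\<lambda>i. \<ominus>\<^bsub>residue_ring (int d)\<^esub> x $ i)"])
        (auto simp: Zvec_group_def Zvec_def R.l_neg)
  qed (auto simp: Zvec_group_def Zvec_def R.a_assoc)
qed

text \<open>A vector is the same as its coordinate function \<open>{..<m} \<rightarrow> {0..<d}\<close>.\<close>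

lemma order_Zvec_group:
  "order (Zvec_group d m) = d ^ m"
proof -
  let ?C = "carrier (residue_ring (int d))"
  have "bij_betw (vec m) ({..<m} \<rightarrow>\<^sub>E ?C) (Zvec d m)"
  proof (rule bij_betw_byWitness[where f' = "\<lambda>x. restrict (vec_index x) {..<m}"])
    have "restrict (vec_index (vec m g)) {..<m} = restrict g {..<m}" for g :: "nat \<Rightarrow> int"
      by (rule restrict_ext) simp
    then show "\<forall>g\<in>{..<m} \<rightarrow>\<^sub>E ?C. restrict (vec_index (vec m g)) {..<m} = g"
      using PiE_restrict by metis
    show "\<forall>x\<in>Zvec d m. vec m (restrict (vec_index x) {..<m}) = x"
      by (auto simp: Zvec_def)
    show "vec m ` ({..<m} \<rightarrow>\<^sub>E ?C) \<subseteq> Zvec d m"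
    proof (rule image_subsetI)
      fix g assume "g \<in> {..<m} \<rightarrow>\<^sub>E ?C"
      then have "g i \<in> ?C" if "i < m" for i
        using that PiE_mem[of g "{..<m}" "\<lambda>_. ?C" i] by simp
      then show "vec m g \<in> Zvec d m"
        by (simp add: Zvec_def)
    qed
    show "(\<lambda>x. restrict (vec_index x) {..<m}) ` Zvec d m \<subseteq> {..<m} \<rightarrow>\<^sub>E ?C"
      by (rule image_subsetI) (simp add: Zvec_def)
  qed
  then have "card (Zvec d m) = card ({..<m} \<rightarrow>\<^sub>E ?C)"
    by (metis bij_betw_same_card)
  then show ?thesis
    by (simp add: order_def Zvec_group_def card_PiE residue_ring_def)
qed

lemma Zmult_mat_vec_hom:
  assumes d: "d > 1" and B: "B \<in> Zmat d m"
  shows "Zmult_mat_vec d B \<in> hom (Zvec_group d m) (Zvec_group d m)"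
proof -
  interpret R: residues "int d" "residue_ring (int d)"
    using residues_of_nat[OF d] .
  let ?R = "residue_ring (int d)"
  have "Zmult_mat_vec d B \<in> Zvec d m \<rightarrow> Zvec d m"
    using finite_dynamical_system_Zmult_mat_vec[OF d B] by (simp add: finite_dynamical_system_def)
  moreover have "Zmult_mat_vec d B (vec m (\<lambda>i. x $ i \<oplus>\<^bsub>?R\<^esub> y $ i)) =
      vec m (\<lambda>i. Zmult_mat_vec d B x $ i \<oplus>\<^bsub>?R\<^esub> Zmult_mat_vec d B y $ i)"
    if x: "x \<in> Zvec d m" and y: "y \<in> Zvec d m" for x y
  proof -
    have "(\<Oplus>\<^bsub>?R\<^esub>j\<in>{..<m}. B $$ (i, j) \<otimes>\<^bsub>?R\<^esub> (vec m (\<lambda>i. x $ i \<oplus>\<^bsub>?R\<^esub> y $ i)) $ j) =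
        (\<Oplus>\<^bsub>?R\<^esub>j\<in>{..<m}. B $$ (i, j) \<otimes>\<^bsub>?R\<^esub> x $ j) \<oplus>\<^bsub>?R\<^esub> (\<Oplus>\<^bsub>?R\<^esub>j\<in>{..<m}. B $$ (i, j) \<otimes>\<^bsub>?R\<^esub> y $ j)"
      if i: "i < m" for i
    proof -
      have cl: "B $$ (i, j) \<in> carrier ?R" "x $ j \<in> carrier ?R" "y $ j \<in> carrier ?R"
        if "j \<in> {..<m}" for j
        using that i x y B by (auto simp: Zvec_def Zmat_def)
      have "(\<Oplus>\<^bsub>?R\<^esub>j\<in>{..<m}. B $$ (i, j) \<otimes>\<^bsub>?R\<^esub> (vec m (\<lambda>i. x $ i \<oplus>\<^bsub>?R\<^esub> y $ i)) $ j) =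
          (\<Oplus>\<^bsub>?R\<^esub>j\<in>{..<m}. B $$ (i, j) \<otimes>\<^bsub>?R\<^esub> x $ j \<oplus>\<^bsub>?R\<^esub> B $$ (i, j) \<otimes>\<^bsub>?R\<^esub> y $ j)"
        using cl by (intro R.finsum_cong') (auto simp: R.r_distr)
      also have "\<dots> = (\<Oplus>\<^bsub>?R\<^esub>j\<in>{..<m}. B $$ (i, j) \<otimes>\<^bsub>?R\<^esub> x $ j)
          \<oplus>\<^bsub>?R\<^esub> (\<Oplus>\<^bsub>?R\<^esub>j\<in>{..<m}. B $$ (i, j) \<otimes>\<^bsub>?R\<^esub> y $ j)"
        using cl by (intro R.finsum_addf) auto
      finally show ?thesis .
    qed
    moreover have "dim_row B = m" "dim_vec x = m" "dim_vec y = m"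
      using B x y by (auto simp: Zmat_def Zvec_def)
    ultimately show ?thesis
      by (auto simp: Zmult_mat_vec_def)
  qed
  ultimately show ?thesis
    by (simp add: hom_def Zvec_group_def)
qed

corollary system_height_Zmult_mat_vec_le:
  assumes "prime p" "B \<in> Zmat p m"
  shows "system_height (Zvec p m) (Zmult_mat_vec p B) \<le> m"
proof -
  have "p > 1" using assms(1) by (rule prime_gt_1_nat)
  then show ?thesis
    using group.system_height_endomorphism_le[OF group_Zvec_group assms(1) order_Zvec_group
        Zmult_mat_vec_hom] assms(2)
    by (simp add: Zvec_group_def)
qed

theorem proposition1p1:
  fixes n m \<omega> :: nat and p e :: "nat \<Rightarrow> nat" and A :: "int mat"
  assumes "n \<ge> 2"
    and "n = (\<Prod>i=1..\<omega>. p i ^ e i)"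
    and "\<And>i. i \<in> {1..\<omega>} \<Longrightarrow> prime (p i)"
    and "inj_on p {1..\<omega>}"
    and "\<And>i. i \<in> {1..\<omega>} \<Longrightarrow> e i \<ge> 1"
    and "m \<ge> 1"
    and "A \<in> Zmat n m"
  shows "let s = (\<lambda>i. system_height (Zvec (p i) m) (Zmult_mat_vec (p i) (mat_mod A (p i))));
             \<mu>\<^sub>A = m * Max (e ` {1..\<omega>});
             \<mu>\<^sub>B = Max ((\<lambda>i. s i * e i) ` {1..\<omega>})
         in \<mu>\<^sub>B \<le> \<mu>\<^sub>A \<and> int \<mu>\<^sub>A \<le> \<lceil>real m * log 2 (real n)\<rceil>"
proof -
  let ?I = "{1..\<omega>}"
  define s where "s = (\<lambda>i. system_height (Zvec (p i) m) (Zmult_mat_vec (p i) (mat_mod A (p i))))"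
  have ne: "?I \<noteq> {}"
  proof
    assume "?I = {}"
    then have "n = 1" using assms(2) by simp
    with assms(1) show False by simp
  qed
  have s_le: "s i \<le> m" if "i \<in> ?I" for i
    unfolding s_def using assms(3)[OF that] assms(7)
    by (intro system_height_Zmult_mat_vec_le mat_mod_in_Zmat)
      (auto simp: Zmat_def prime_gt_0_nat)
  have "s i * e i \<le> m * Max (e ` ?I)" if "i \<in> ?I" for i
    using that s_le by (intro mult_le_mono) auto
  then have B_le_A: "Max ((\<lambda>i. s i * e i) ` ?I) \<le> m * Max (e ` ?I)"
    using ne by (subst Max_le_iff) auto
  have "Max (e ` ?I) \<in> e ` ?I"
    using ne by (intro Max_in) auto
  then obtain i where i: "i \<in> ?I" "Max (e ` ?I) = e i"
    by auto
  have "2 ^ e i \<le> p i ^ e i"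
    using assms(3)[OF i(1)] by (intro power_mono) (auto simp: prime_ge_2_nat)
  also have "p i ^ e i \<le> n"
  proof (rule dvd_imp_le)
    show "p i ^ e i dvd n"
      unfolding assms(2) using i(1) by (intro dvd_prodI) auto
    show "0 < n" using assms(1) by simp
  qed
  finally have "2 ^ e i \<le> n" .
  then have "real (e i) \<le> log 2 (real n)"
    using assms(1) by (intro le_log_of_power) auto
  then have "real (m * e i) \<le> real m * log 2 (real n)"
    by (simp add: mult_left_mono)
  then have "int (m * e i) \<le> \<lceil>real m * log 2 (real n)\<rceil>"
    by linarith
  with B_le_A i(2) show ?thesis
    unfolding Let_def s_def by simp
qed

end
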